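(* The set $\mathcal{H}_*$ of quasitubes (with pointwise vector space operations, composition as multiplication, Hilbert space adjoint as involution, and the operator norm $\|\cdot\|_{\mathcal{H}_*}$) is a commutative, unital C*-algebra over $\mathbb{F}$, and it is isometrically *-isomorphic to $\ell_\infty=\ell_\infty(\mathbb{Z})$ (bounded $\mathbb{F}$-valued sequences with entrywise multiplication, entrywise complex conjugation, and the supremum norm).
   Context: $\mathbb{F}$ is $\mathbb{R}$ or $\mathbb{C}$. $\mathcal{H}$ is a separable infinite-dimensional Hilbert space over $\mathbb{F}$ (inner product linear in the first argument) with a fixed orthonormal basis $F=\{\phi^{(j)}\}_{j\in\mathbb{Z}}$. For $x\in\mathcal{H}$ put $\widehat{x}_j=\langle x,\phi^{(j)}\rangle_{\mathcal{H}}$, and define $x\star_F y=\sum_{j\in\mathbb{Z}}\widehat{x}_j\widehat{y}_j\phi^{(j)}\in\mathcal{H}$. A map $T:\mathcal{H}\to\mathcal{H}$ is $\mathcal{H}$-linear if $T(a\star_F x+b\star_F y)=a\star_F T(x)+b\star_F T(y)$ for all $a,b,x,y\in\mathcal{H}$. A quasitube is a bounded $\mathcal{H}$-linear operator $q:\mathcal{H}\to\mathcal{H}$; $\mathcal{H}_*$ is the set of quasitubes, with norm $\|q\|_{\mathcal{H}_*}=\sup_{\|x\|_{\mathcal{H}}=1}\|q(x)\|_{\mathcal{H}}$, and $q^*$ is the adjoint of $q$ with respect to $\langle\cdot,\cdot\rangle_{\mathcal{H}}$. A C*-algebra over $\mathbb{F}$ is a Banach algebra over $\mathbb{F}$ that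 is also a *-algebra (conjugate-linear involution, $(xy)^*=y^*x^*$) and satisfies $\|x^*x\|=\|x^*\|\,\|x\|=\|x\|^2$. An isometric *-isomorphism is a bijective algebra homomorphism that preserves the involution and the norm. *)

theory Defs
  imports
    "HOL-Analysis.Analysis"
    "HOL-Algebra.Algebraic_Closure_Type"
begin

section \<open>The scalar field: real or complex numbers\<close>

text \<open>
  The axioms make every scalar \<open>z\<close> a root of a real polynomial of degree two, so the types of
  this class are exactly the copies of the real field with trivial conjugation and of the complex
  field with complex conjugation, each with its usual norm; see \<open>real_or_complex_cases\<close> below.
\<close>

class real_or_complex = real_normed_field +
  fixes cconj :: "'a \<Rightarrow> 'a"
  assumes cconj_add: "cconj (x + y) = cconj x + cconj y"
    and cconj_mult: "cconj (x * y) = cconj x * cconj y"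
    and mult_cconj_scaleR: "x * cconj x = (norm x)\<^sup>2 *\<^sub>R 1"
    and add_cconj_scaleR: "\<exists>r. x + cconj x = r *\<^sub>R 1"

lemma mult_cconj: "x * cconj x = of_real ((norm x)\<^sup>2)" for x :: "'a::real_or_complex"
  by (simp add: mult_cconj_scaleR of_real_def)

lemma add_cconj: "\<exists>r. x + cconj x = of_real r" for x :: "'a::real_or_complex"
  using add_cconj_scaleR[of x] by (simp add: of_real_def)

instantiation real :: real_or_complex
begin
definition cconj_real :: "real \<Rightarrow> real" where "cconj_real x = x"
instance by standard (auto simp: cconj_real_def power2_eq_square)
end

instantiation complex :: real_or_complex
begin
definition cconj_complex :: "complex \<Rightarrow> complex" where "cconj_complex = cnj"
instance
proof
  fix x y :: complex
  show "x * cconj x = (norm x)\<^sup>2 *\<^sub>R 1"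
    by (simp add: cconj_complex_def complex_norm_square[symmetric] scaleR_conv_of_real del: of_real_power)
  show "\<exists>r. x + cconj x = r *\<^sub>R 1"
    by (intro exI[of _ "2 * Re x"]) (simp add: cconj_complex_def complex_add_cnj scaleR_conv_of_real)
qed (simp_all add: cconj_complex_def)
end

lemma cconj_of_real: "cconj (of_real r) = (of_real r :: 'a::real_or_complex)"
proof (cases "r = 0")
  case True
  then show ?thesis using cconj_add[of "0::'a" 0] by simp
next
  case False
  have "of_real r * cconj (of_real r) = (of_real r * of_real r :: 'a)"
    by (simp add: mult_cconj power2_eq_square)
  then show ?thesis using False by simp
qed

lemma real_or_complex_cases:
  "(bij (of_real :: real \<Rightarrow> 'a) \<and> (\<forall>z::'a. cconj z = z)) \<or>
   (\<exists>h :: complex \<Rightarrow> 'a::real_or_complex. bij h \<and>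
      (\<forall>x y. h (x + y) = h x + h y) \<and> (\<forall>x y. h (x * y) = h x * h y) \<and>
      (\<forall>r. h (of_real r) = of_real r) \<and>
      (\<forall>x. h (cnj x) = cconj (h x)) \<and> (\<forall>x. norm (h x) = norm x))"
proof (cases "\<forall>z::'a. z \<in> \<real>")
  case True
  then have "range (of_real :: real \<Rightarrow> 'a) = UNIV" by (auto simp: Reals_def)
  moreover have "inj (of_real :: real \<Rightarrow> 'a)" by (auto simp: inj_def)
  moreover have "cconj z = z" for z :: 'a
    using True cconj_of_real by (metis Reals_cases)
  ultimately show ?thesis by (auto simp: bij_def)
next
  case False
  then obtain z :: 'a where z: "z \<notin> \<real>" by blast
  obtain t where t: "z + cconj z = of_real t" using add_cconj by blast
  define w where "w = z - of_real (t/2)"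
  have w0: "w \<noteq> 0" using z unfolding w_def by (metis Reals_of_real eq_iff_diff_eq_0)
  have "z = w + of_real (t/2)" by (simp add: w_def)
  with t have "w + of_real (t/2) + (cconj w + of_real (t/2)) = of_real t"
    by (metis cconj_add cconj_of_real)
  then have "w + cconj w + of_real (t/2 + t/2) = of_real t"
    unfolding of_real_add by (simp add: algebra_simps)
  then have wc: "cconj w = - w" by (simp add: eq_neg_iff_add_eq_0 add.commute)
  define i where "i = of_real (inverse (norm w)) * w"
  have ic: "cconj i = - i" by (simp add: i_def cconj_mult cconj_of_real wc del: of_real_inverse)
  have ni: "norm i = 1" using w0 by (simp add: i_def norm_mult norm_inverse)
  have ii: "i * i = - 1" using mult_cconj[of i] ic ni
    by (metis minus_minus mult_minus_right of_real_1 one_power2)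
  define h :: "complex \<Rightarrow> 'a" where "h c = of_real (Re c) + of_real (Im c) * i" for c
  have h_add: "h (x + y) = h x + h y" for x y by (simp add: h_def algebra_simps)
  have h_mult: "h (x * y) = h x * h y" for x y
  proof -
    have "h x * h y = of_real (Re x) * of_real (Re y) + of_real (Im x) * of_real (Im y) * (i * i)
        + (of_real (Re x) * of_real (Im y) + of_real (Im x) * of_real (Re y)) * i"
      by (simp add: h_def algebra_simps)
    then show ?thesis unfolding ii by (simp add: h_def algebra_simps)
  qed
  have h_real: "h (of_real r) = of_real r" for r by (simp add: h_def)
  have h_cnj: "h (cnj x) = cconj (h x)" for x
    by (simp add: h_def cconj_add cconj_mult cconj_of_real ic)
  have h_norm: "norm (h x) = norm x" for x
  proof -
    have "of_real ((norm (h x))\<^sup>2) = h (x * cnj x)" by (simp add: h_mult h_cnj mult_cconj)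
    also have "\<dots> = of_real ((norm x)\<^sup>2)"
      by (simp only: complex_norm_square[symmetric] h_real of_real_power[symmetric])
    finally have "(norm (h x))\<^sup>2 = (norm x)\<^sup>2" using of_real_eq_iff by blast
    then show ?thesis by simp
  qed
  have "inj h"
  proof (rule injI)
    fix x y assume "h x = h y"
    then have "h (x - y) = 0" using h_add[of "x - y" y] by simp
    then show "x = y" using h_norm[of "x - y"] by simp
  qed
  moreover have "\<exists>c. h c = v" for v
  proof -
    obtain s where s: "v + cconj v = of_real s" using add_cconj by blast
    obtain u where u: "v * i + cconj (v * i) = of_real u" using add_cconj by blast
    have "(v - cconj v) * i = of_real u" using u by (simp add: cconj_mult ic algebra_simps)
    then have "(v - cconj v) * (i * i) = of_real u * i" by (simp add: mult.assoc)
    then have d: "v - cconj v = - of_real u * i" unfolding ii by (metis minus_minus mult_minus_left mult_minus_right mult_1_right)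
    have "2 * v = (v + cconj v) + (v - cconj v)" by simp
    also have "\<dots> = of_real s - of_real u * i" unfolding s d by simp
    finally have "2 * v = of_real s - of_real u * i" .
    then have "h (Complex (s/2) (-u/2)) = v"
      by (simp add: h_def field_simps)
    then show ?thesis by blast
  qed
  ultimately have "bij h" by (metis bij_def surj_def)
  with h_add h_mult h_real h_cnj h_norm show ?thesis by blast
qed


section \<open>C*-algebras over the scalar field\<close>

record ('f, 'b) normed_star_algebra = "('f, 'b) module" +
  involution :: "'b \<Rightarrow> 'b"
  anorm :: "'b \<Rightarrow> real"

text \<open>
  The record field \<open>one\<close> is not constrained here: Banach algebras and C*-algebras
  need not be unital. Unitality is expressed by adding the locale \<open>ring\<close> (or \<open>cring\<close>).
\<close>

locale banach_algebra = module ring_of_type_algebra A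
  for A :: "('f::real_or_complex, 'b, 'm) normed_star_algebra_scheme" (structure) +
  assumes mult_closed: "\<lbrakk>x \<in> carrier A; y \<in> carrier A\<rbrakk> \<Longrightarrow> x \<otimes> y \<in> carrier A"
    and mult_assoc: "\<lbrakk>x \<in> carrier A; y \<in> carrier A; z \<in> carrier A\<rbrakk>
      \<Longrightarrow> (x \<otimes> y) \<otimes> z = x \<otimes> (y \<otimes> z)"
    and distrib_right: "\<lbrakk>x \<in> carrier A; y \<in> carrier A; z \<in> carrier A\<rbrakk>
      \<Longrightarrow> (x \<oplus> y) \<otimes> z = x \<otimes> z \<oplus> y \<otimes> z"
    and distrib_left: "\<lbrakk>x \<in> carrier A; y \<in> carrier A; z \<in> carrier A\<rbrakk>
      \<Longrightarrow> z \<otimes> (x \<oplus> y) = z \<otimes> x \<oplus> z \<otimes> y"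
    and smult_mult_left: "\<lbrakk>x \<in> carrier A; y \<in> carrier A\<rbrakk>
      \<Longrightarrow> (c \<odot> x) \<otimes> y = c \<odot> (x \<otimes> y)"
    and smult_mult_right: "\<lbrakk>x \<in> carrier A; y \<in> carrier A\<rbrakk>
      \<Longrightarrow> x \<otimes> (c \<odot> y) = c \<odot> (x \<otimes> y)"
    and anorm_nonneg: "x \<in> carrier A \<Longrightarrow> 0 \<le> anorm A x"
    and anorm_eq_0_iff: "x \<in> carrier A \<Longrightarrow> anorm A x = 0 \<longleftrightarrow> x = \<zero>"
    and anorm_smult: "x \<in> carrier A \<Longrightarrow> anorm A (c \<odot> x) = norm c * anorm A x"
    and anorm_triangle: "\<lbrakk>x \<in> carrier A; y \<in> carrier A\<rbrakk>
      \<Longrightarrow> anorm A (x \<oplus> y) \<le> anorm A x + anorm A y"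
    and anorm_mult: "\<lbrakk>x \<in> carrier A; y \<in> carrier A\<rbrakk>
      \<Longrightarrow> anorm A (x \<otimes> y) \<le> anorm A x * anorm A y"
    and complete:
      "\<lbrakk>\<And>n. s n \<in> carrier A; \<And>e. 0 < e \<Longrightarrow> \<exists>N::nat. \<forall>m\<ge>N. \<forall>n\<ge>N. anorm A (s m \<ominus> s n) < e\<rbrakk>
      \<Longrightarrow> \<exists>l\<in>carrier A. (\<lambda>n. anorm A (s n \<ominus> l)) \<longlonglongrightarrow> 0"

locale cstar_algebra = banach_algebra A
  for A :: "('f::real_or_complex, 'b, 'm) normed_star_algebra_scheme" (structure) +
  assumes involution_closed: "x \<in> carrier A \<Longrightarrow> involution A x \<in> carrier A"
    and involution_involution: "x \<in> carrier A \<Longrightarrow> involution A (involution A x) = x"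
    and involution_add: "\<lbrakk>x \<in> carrier A; y \<in> carrier A\<rbrakk>
      \<Longrightarrow> involution A (x \<oplus> y) = involution A x \<oplus> involution A y"
    and involution_smult: "x \<in> carrier A
      \<Longrightarrow> involution A (c \<odot> x) = cconj c \<odot> involution A x"
    and involution_mult: "\<lbrakk>x \<in> carrier A; y \<in> carrier A\<rbrakk>
      \<Longrightarrow> involution A (x \<otimes> y) = involution A y \<otimes> involution A x"
    and cstar_identity: "x \<in> carrier A
      \<Longrightarrow> anorm A (involution A x \<otimes> x) = anorm A (involution A x) * anorm A x"
      "x \<in> carrier A \<Longrightarrow> anorm A (involution A x) * anorm A x = (anorm A x)\<^sup>2"

locale commutative_unital_cstar_algebra = cstar_algebra A + cring A
  for A :: "('f::real_or_complex, 'b, 'm) normed_star_algebra_scheme" (structure)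

text \<open>
  For unital algebras: \<open>ring_hom\<close> includes preservation of the unit, which is automatic
  for a bijective homomorphism.
\<close>

definition isometric_star_isomorphism ::
  "('f, 'b, 'm) normed_star_algebra_scheme \<Rightarrow> ('f, 'c, 'n) normed_star_algebra_scheme \<Rightarrow> ('b \<Rightarrow> 'c) \<Rightarrow> bool"
  where "isometric_star_isomorphism A B f \<longleftrightarrow>
    bij_betw f (carrier A) (carrier B) \<and>
    f \<in> ring_hom A B \<and>
    (\<forall>c. \<forall>x\<in>carrier A. f (c \<odot>\<^bsub>A\<^esub> x) = c \<odot>\<^bsub>B\<^esub> f x) \<and>
    (\<forall>x\<in>carrier A. f (involution A x) = involution B (f x)) \<and>
    (\<forall>x\<in>carrier A. anorm B (f x) = anorm A x)"

definition ell_infinity :: "('f::real_or_complex, int \<Rightarrow> 'f) normed_star_algebra" where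
  "ell_infinity =
    \<lparr> carrier = {a. bounded (range a)},
      mult = (\<lambda>a b j. a j * b j),
      one = (\<lambda>j. 1),
      zero = (\<lambda>j. 0),
      add = (\<lambda>a b j. a j + b j),
      smult = (\<lambda>c a j. c * a j),
      involution = (\<lambda>a j. cconj (a j)),
      anorm = (\<lambda>a. SUP j. norm (a j)) \<rparr>"


section \<open>Hilbert spaces with an orthonormal basis\<close>

text \<open>
  The class \<open>banach\<close> supplies addition, norm and completeness; \<open>scale\<close> is the
  multiplication by scalars from the field and \<open>ip\<close> the inner product inducing the norm.
\<close>

locale hilbert_space = vector_space scale
  for scale :: "'f::real_or_complex \<Rightarrow> 'h::banach \<Rightarrow> 'h" +
  fixes ip :: "'h \<Rightarrow> 'h \<Rightarrow> 'f"
  assumes scale_of_real: "scale (of_real r) x = r *\<^sub>R x"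
    and ip_add_left: "ip (x + y) z = ip x z + ip y z"
    and ip_scale_left: "ip (scale c x) y = c * ip x y"
    and ip_commute: "ip y x = cconj (ip x y)"
    and ip_self: "ip x x = of_real ((norm x)\<^sup>2)"

text \<open>
  An orthonormal basis indexed by the integers exists precisely when the Hilbert space is
  separable and infinite-dimensional, so these two properties need no separate assumption.
\<close>

locale hilbert_space_with_basis = hilbert_space scale ip
  for scale :: "'f::real_or_complex \<Rightarrow> 'h::banach \<Rightarrow> 'h" and ip :: "'h \<Rightarrow> 'h \<Rightarrow> 'f" +
  fixes \<phi> :: "int \<Rightarrow> 'h"
  assumes orthonormal: "ip (\<phi> i) (\<phi> j) = (if i = j then 1 else 0)"
    and total: "closure (span (range \<phi>)) = UNIV"
begin

definition coefficient :: "'h \<Rightarrow> int \<Rightarrow> 'f" where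
  "coefficient x j = ip x (\<phi> j)"

text \<open>
  The series below always converges: the products of two square-summable coefficient
  sequences are square-summable.
\<close>

definition star_product :: "'h \<Rightarrow> 'h \<Rightarrow> 'h" (infixl \<open>\<star>\<close> 70) where
  "x \<star> y = (\<Sum>\<^sub>\<infinity>j. scale (coefficient x j * coefficient y j) (\<phi> j))"

definition H_linear :: "('h \<Rightarrow> 'h) \<Rightarrow> bool" where
  "H_linear T \<longleftrightarrow> (\<forall>a b x y. T (a \<star> x + b \<star> y) = a \<star> T x + b \<star> T y)"

definition quasitubes :: "('h \<Rightarrow> 'h) set" where
  "quasitubes = {q. H_linear q \<and> (\<exists>K. \<forall>x. norm (q x) \<le> K * norm x)}"

definition quasitube_norm :: "('h \<Rightarrow> 'h) \<Rightarrow> real" where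
  "quasitube_norm q = (SUP x\<in>{x. norm x = 1}. norm (q x))"

definition hilbert_adjoint :: "('h \<Rightarrow> 'h) \<Rightarrow> ('h \<Rightarrow> 'h)" where
  "hilbert_adjoint q = (THE r. \<forall>x y. ip (q x) y = ip x (r y))"

definition quasitube_algebra :: "('f, 'h \<Rightarrow> 'h) normed_star_algebra" where
  "quasitube_algebra =
    \<lparr> carrier = quasitubes,
      mult = (\<lambda>p q. p \<circ> q),
      one = id,
      zero = (\<lambda>x. 0),
      add = (\<lambda>p q x. p x + q x),
      smult = (\<lambda>c q x. scale c (q x)),
      involution = hilbert_adjoint,
      anorm = quasitube_norm \<rparr>"

end

end

theory Submission
  imports Defs
begin

text \<open>
  Multiplying by a bounded sequence in the coordinates of the basis gives a diagonal operator.
  Testing \<open>\<H>\<close>-linearity of a quasitube \<open>q\<close> against the basis vectors shows that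
  \<open>q\<close> commutes with all coordinate projections, so the quasitubes are exactly the diagonal operators
  of bounded sequences. Sending a sequence to its diagonal operator respects the algebra operations, turns
  complex conjugation into the adjoint and the supremum norm into the operator norm, and the
  C*-algebra axioms are transported along it from \<open>\<ell>\<^sub>\<infinity>\<close>, where completeness is that of uniform convergence.
\<close>

section \<open>Conjugation and completeness of the scalar field\<close>

text \<open>The trace \<open>x + cconj x\<close> is a real scalar, so conjugation fixes it;
  cancelling \<open>cconj x\<close> leaves the claim.\<close>

lemma cconj_cconj [simp]: "cconj (cconj x) = (x :: 'f::real_or_complex)"
proof -
  obtain r where r: "x + cconj x = of_real r"
    using add_cconj by blast
  then have "cconj x + cconj (cconj x) = of_real r"
    by (metis cconj_add cconj_of_real)
  with r show ?thesis
    by (metis add.commute add_right_imp_eq)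
qed

text \<open>Since conjugation is an involution, the product \<open>x * cconj x\<close>, which
  determines the norm, is the same for \<open>x\<close> and \<open>cconj x\<close>.\<close>

lemma norm_cconj [simp]: "norm (cconj x) = norm (x :: 'f::real_or_complex)"
proof -
  have "(of_real ((norm (cconj x))\<^sup>2) :: 'f) = of_real ((norm x)\<^sup>2)"
    using mult_cconj[of "cconj x"] mult_cconj[of x] by (simp add: mult.commute)
  then have "(norm (cconj x))\<^sup>2 = (norm x)\<^sup>2"
    using of_real_eq_iff by blast
  then show ?thesis by simp
qed

lemma cconj_zero [simp]: "cconj 0 = (0 :: 'f::real_or_complex)"
  using cconj_of_real[of 0, where 'a='f] by simp

text \<open>The class does not assume completeness; it comes from the classification as a copy of
  the reals or the complex numbers. Uniform limits of scalar sequences depend on it.\<close>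

instance real_or_complex \<subseteq> complete_space
proof
  fix s :: "nat \<Rightarrow> 'a"
  assume Cauchy: "Cauchy s"
  \<comment> \<open>A surjective isometry carries completeness over: pull the sequence back, take
    the limit there and map it forward.\<close>
  have transfer: "convergent s"
    if h: "surj h" "\<And>x y. dist (h x) (h y) = dist x y" for h :: "'b::complete_space \<Rightarrow> 'a"
  proof -
    define t where "t n = inv_into UNIV h (s n)" for n
    have st: "s n = h (t n)" for n
      using h(1) by (simp add: t_def surj_f_inv_f)
    have "Cauchy t"
      using Cauchy by (simp add: Cauchy_def st h(2))
    then obtain l where "t \<longlonglongrightarrow> l"
      using Cauchy_convergent convergent_def by blast
    then have "s \<longlonglongrightarrow> h l"
      by (simp add: lim_sequentially st h(2))
    then show ?thesis by (auto simp: convergent_def)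
  qed
  show "convergent s"
    using real_or_complex_cases[where 'a='a]
  proof
    assume "bij (of_real :: real \<Rightarrow> 'a) \<and> (\<forall>z::'a. cconj z = z)"
    then show ?thesis
      by (intro transfer[of "of_real :: real \<Rightarrow> 'a"])
        (auto simp: bij_def dist_norm norm_of_real simp flip: of_real_diff)
  next
    assume "\<exists>h :: complex \<Rightarrow> 'a. bij h \<and>
      (\<forall>x y. h (x + y) = h x + h y) \<and> (\<forall>x y. h (x * y) = h x * h y) \<and>
      (\<forall>r. h (of_real r) = of_real r) \<and>
      (\<forall>x. h (cnj x) = cconj (h x)) \<and> (\<forall>x. norm (h x) = norm x)"
    then obtain h :: "complex \<Rightarrow> 'a" where h: "bij h" "\<And>x y. h (x + y) = h x + h y"
      "\<And>x. norm (h x) = norm x" by blast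
    have "h x - h y = h (x - y)" for x y
      using h(2)[of "x - y" y] by simp
    then show ?thesis
      using h by (intro transfer[of h]) (auto simp: bij_def dist_norm)
  qed
qed

section \<open>Bounded sequences as a commutative unital C*-algebra\<close>

lemma cring_ring_of_type_algebra: "cring (ring_of_type_algebra :: 'f::real_or_complex ring)"
  by (rule cring_from_type_algebra)

lemma ring_of_type_algebra_simps [simp]:
  "carrier (ring_of_type_algebra :: 'f::real_or_complex ring) = UNIV"
  "x \<otimes>\<^bsub>ring_of_type_algebra\<^esub> y = x * (y::'f)"
  "\<one>\<^bsub>ring_of_type_algebra\<^esub> = (1::'f)"
  "x \<oplus>\<^bsub>ring_of_type_algebra\<^esub> y = x + y"
  by (simp_all add: ring_of_type_algebra_def)

lemma ell_infinity_simps [simp]: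
  fixes a b :: "int \<Rightarrow> 'f::real_or_complex"
  shows "a \<in> carrier ell_infinity \<longleftrightarrow> bounded (range a)"
    "a \<otimes>\<^bsub>ell_infinity\<^esub> b = (\<lambda>j. a j * b j)"
    "\<one>\<^bsub>ell_infinity\<^esub> = (\<lambda>j. 1 :: 'f)"
    "\<zero>\<^bsub>ell_infinity\<^esub> = (\<lambda>j. 0 :: 'f)"
    "a \<oplus>\<^bsub>ell_infinity\<^esub> b = (\<lambda>j. a j + b j)"
    "c \<odot>\<^bsub>ell_infinity\<^esub> a = (\<lambda>j. c * a j)"
    "involution ell_infinity a = (\<lambda>j. cconj (a j))"
    "anorm ell_infinity a = (SUP j. norm (a j))"
  by (simp_all add: ell_infinity_def)

lemma norm_le_SUP:
  fixes a :: "'i \<Rightarrow> 'a::real_normed_vector"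
  assumes "bounded (range a)"
  shows "norm (a j) \<le> (SUP j. norm (a j))"
  using assms by (intro cSUP_upper) (auto simp: bounded_iff bdd_above_def)

lemma bounded_range_mult:
  fixes a b :: "'i \<Rightarrow> 'a::real_normed_algebra"
  assumes "bounded (range a)" "bounded (range b)"
  shows "bounded (range (\<lambda>j. a j * b j))"
proof -
  have "norm (a j * b j) \<le> (SUP j. norm (a j)) * (SUP j. norm (b j))" for j
    using norm_le_SUP[OF assms(1), of j] norm_le_SUP[OF assms(2), of j]
    by (intro order_trans[OF norm_mult_ineq] mult_mono) (auto intro: order_trans[OF norm_ge_zero])
  then show ?thesis by (auto simp: bounded_iff)
qed

lemma bounded_range_add:
  fixes a b :: "'i \<Rightarrow> 'a::real_normed_vector"
  assumes "bounded (range a)" "bounded (range b)"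
  shows "bounded (range (\<lambda>j. a j + b j))"
  using bounded_plus_comp[of a UNIV b] assms by simp

lemma bounded_range_cconj:
  fixes a :: "'i \<Rightarrow> 'f::real_or_complex"
  shows "bounded (range a) \<Longrightarrow> bounded (range (\<lambda>j. cconj (a j)))"
  by (auto simp: bounded_iff)

lemma bounded_range_const: "bounded (range (\<lambda>j. c))"
  by simp

text \<open>Squaring is monotone on nonnegative reals and \<open>sqrt\<close> inverts it, so each
  gives one inequality. This is the C*-identity for the supremum norm.\<close>

lemma SUP_power2:
  fixes u :: "'i \<Rightarrow> real"
  assumes "\<And>j. 0 \<le> u j" "bdd_above (range u)"
  shows "(SUP j. (u j)\<^sup>2) = (SUP j. u j)\<^sup>2"
proof (rule antisym)
  have u: "u j \<le> (SUP j. u j)" for j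
    using assms(2) by (intro cSUP_upper) auto
  then have le: "(u j)\<^sup>2 \<le> (SUP j. u j)\<^sup>2" for j
    by (rule power_mono) (rule assms)
  then show "(SUP j. (u j)\<^sup>2) \<le> (SUP j. u j)\<^sup>2"
    by (intro cSUP_least) auto
  from le have bdd: "bdd_above (range (\<lambda>j. (u j)\<^sup>2))"
    by (auto simp: bdd_above_def)
  have "u j \<le> sqrt (SUP j. (u j)\<^sup>2)" for j
    by (intro real_le_rsqrt cSUP_upper bdd) auto
  then have "(SUP j. u j) \<le> sqrt (SUP j. (u j)\<^sup>2)"
    by (intro cSUP_least) auto
  moreover have "0 \<le> (SUP j. u j)"
    using u assms(1) order_trans by blast
  ultimately have "(SUP j. u j)\<^sup>2 \<le> (sqrt (SUP j. (u j)\<^sup>2))\<^sup>2"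
    by (rule power_mono)
  \<comment> \<open>A lower bound for the supremum takes a single index; types are nonempty, so
    \<open>undefined\<close> serves.\<close>
  moreover have "0 \<le> (SUP j. (u j)\<^sup>2)"
    using bdd by (intro cSUP_upper2[where x = undefined]) auto
  ultimately show "(SUP j. u j)\<^sup>2 \<le> (SUP j. (u j)\<^sup>2)"
    by simp
qed

lemma cring_ell_infinity: "cring (ell_infinity :: ('f::real_or_complex, int \<Rightarrow> 'f) normed_star_algebra)"
proof (rule cringI)
  show "abelian_group (ell_infinity :: ('f, int \<Rightarrow> 'f) normed_star_algebra)"
  proof (rule abelian_groupI, goal_cases)
    case (6 x)
    then show ?case
      by (intro bexI[of _ "\<lambda>j. - x j"]) (auto simp: bounded_iff)
  qed (auto simp: bounded_range_add add_ac)
  show "comm_monoid (ell_infinity :: ('f, int \<Rightarrow> 'f) normed_star_algebra)"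
    by (rule comm_monoidI) (auto simp: bounded_range_mult mult_ac)
qed (auto simp: algebra_simps)

text \<open>The completeness axiom is phrased with the abstract subtraction, which is defined
  through additive inverses and has to be made explicit.\<close>

lemma minus_ell_infinity:
  fixes a b :: "int \<Rightarrow> 'f::real_or_complex"
  assumes "bounded (range a)" "bounded (range b)"
  shows "a \<ominus>\<^bsub>ell_infinity\<^esub> b = (\<lambda>j. a j - b j)"
proof -
  interpret cring "ell_infinity :: ('f, int \<Rightarrow> 'f) normed_star_algebra"
    by (rule cring_ell_infinity)
  have "\<ominus>\<^bsub>ell_infinity\<^esub> b = (\<lambda>j. - b j)"
    using assms by (intro minus_equality) (auto simp: bounded_iff)
  then show ?thesis by (simp add: a_minus_def)
qed

text \<open>Cauchy in the supremum norm means uniformly Cauchy, so completeness of the scalars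
  yields a uniform limit, which is bounded because it stays close to one bounded term.\<close>

lemma ell_infinity_complete:
  fixes s :: "nat \<Rightarrow> int \<Rightarrow> 'f::real_or_complex"
  assumes s: "\<And>n. bounded (range (s n))"
    and Cauchy: "\<And>e. 0 < e \<Longrightarrow> \<exists>N. \<forall>m\<ge>N. \<forall>n\<ge>N. (SUP j. norm (s m j - s n j)) < e"
  shows "\<exists>l. bounded (range l) \<and> (\<lambda>n. SUP j. norm (s n j - l j)) \<longlonglongrightarrow> 0"
proof -
  have bd: "bounded (range (\<lambda>j. s m j - s n j))" for m n
    using s[of m] s[of n] bounded_minus_comp[of "s m" UNIV "s n"] by simp
  have "uniformly_Cauchy_on UNIV s"
  proof (rule uniformly_Cauchy_onI)
    fix e :: real assume "0 < e"
    from Cauchy[OF this] obtain N where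
      "\<forall>m\<ge>N. \<forall>n\<ge>N. (SUP j. norm (s m j - s n j)) < e" by blast
    with norm_le_SUP[OF bd] have "\<forall>x\<in>UNIV. \<forall>m\<ge>N. \<forall>n\<ge>N. dist (s m x) (s n x) < e"
      unfolding dist_norm by (meson order_le_less_trans)
    then show "\<exists>N. \<forall>x\<in>UNIV. \<forall>m\<ge>N. \<forall>n\<ge>N. dist (s m x) (s n x) < e" by blast
  qed
  then obtain l where l: "uniform_limit UNIV s l sequentially"
    using Cauchy_uniformly_convergent unfolding uniformly_convergent_on_def by blast
  have lim: "\<exists>N. \<forall>n\<ge>N. \<forall>j. norm (s n j - l j) < e" if "0 < e" for e
    using l that unfolding uniform_limit_sequentially_iff dist_norm by auto
  have "bounded (range l)"
  proof -
    obtain N where "\<And>j. norm (s N j - l j) < 1"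
      using lim[of 1] by auto
    then have "bounded (range (\<lambda>j. s N j - l j))"
      by (auto simp: bounded_iff intro!: exI[of _ 1] less_imp_le)
    then show ?thesis
      using bounded_minus_comp[of "s N" UNIV "\<lambda>j. s N j - l j"] s by simp
  qed
  moreover have "(\<lambda>n. SUP j. norm (s n j - l j)) \<longlonglongrightarrow> 0"
  proof (rule LIMSEQ_I)
    fix e :: real assume "0 < e"
    \<comment> \<open>Passing to the supremum weakens the strict bound, and \<open>e / 2\<close>
      leaves room for a strict one.\<close>
    then obtain N where N: "\<And>n j. N \<le> n \<Longrightarrow> norm (s n j - l j) < e / 2"
      using lim[of "e / 2"] by auto
    have "norm ((SUP j. norm (s n j - l j)) - 0) < e" if "N \<le> n" for n
    proof -
      have "(SUP j. norm (s n j - l j)) \<le> e / 2"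
        using N[OF that] by (intro cSUP_least) (auto intro: less_imp_le)
      moreover have "bdd_above (range (\<lambda>j. norm (s n j - l j)))"
        using N[OF that] by (auto simp: bdd_above_def intro!: exI[of _ "e / 2"] less_imp_le)
      then have "0 \<le> (SUP j. norm (s n j - l j))"
        by (intro cSUP_upper2[where x = undefined]) auto
      ultimately show ?thesis using \<open>0 < e\<close> by simp
    qed
    then show "\<exists>N. \<forall>n\<ge>N. norm ((SUP j. norm (s n j - l j)) - 0) < e" by blast
  qed
  ultimately show ?thesis by blast
qed

theorem commutative_unital_cstar_algebra_ell_infinity:
  "commutative_unital_cstar_algebra (ell_infinity :: ('f::real_or_complex, int \<Rightarrow> 'f) normed_star_algebra)"
  (is "commutative_unital_cstar_algebra ?A")
proof (intro commutative_unital_cstar_algebra.intro cstar_algebra.intro banach_algebra.intro)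
  interpret cring ?A by (rule cring_ell_infinity)
  show "cring ?A" ..
  show "Module.module ring_of_type_algebra ?A"
    by (rule moduleI)
      (auto simp: bounded_range_mult algebra_simps cring_ring_of_type_algebra is_abelian_group)
  have nonneg: "0 \<le> (SUP j. norm (a j))" if "bounded (range a)" for a :: "int \<Rightarrow> 'f"
    using norm_le_SUP[OF that] norm_ge_zero order_trans by blast
  show "banach_algebra_axioms ?A"
  \<comment> \<open>Cases 7 to 11 are the norm axioms and case 12 is completeness; the algebraic
    axioms hold entrywise.\<close>
  proof (rule banach_algebra_axioms.intro, goal_cases)
    case (7 x)
    then show ?case using nonneg by simp
  next
    case (8 x)
    then have "x = (\<lambda>j. 0)" if "(SUP j. norm (x j)) = 0"
      using norm_le_SUP[of x] that by (simp add: fun_eq_iff)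
    then show ?case by auto
  next
    case (9 x c)
    then have x: "bounded (range x)" by simp
    have "(SUP j. norm (c * x j)) = norm c * (SUP j. norm (x j))"
    proof (rule antisym)
      show "(SUP j. norm (c * x j)) \<le> norm c * (SUP j. norm (x j))"
        by (intro cSUP_least) (auto simp: norm_mult intro!: mult_left_mono norm_le_SUP x)
      show "norm c * (SUP j. norm (x j)) \<le> (SUP j. norm (c * x j))"
      proof (cases "c = 0")
        case False
        \<comment> \<open>Each entry of \<open>x\<close> is recovered from the scaled sequence by
          dividing by \<open>norm c\<close>, hence the case split.\<close>
        have "norm (x j) \<le> (SUP j. norm (c * x j)) / norm c" for j
          using norm_le_SUP[OF bounded_range_mult[OF bounded_range_const x], of c j] False
          by (simp add: norm_mult field_simps)
        then have "(SUP j. norm (x j)) \<le> (SUP j. norm (c * x j)) / norm c"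
          by (intro cSUP_least) auto
        then show ?thesis using False by (simp add: field_simps)
      qed simp
    qed
    then show ?case by simp
  next
    case (10 x y)
    then show ?case
      by (auto intro!: cSUP_least order_trans[OF norm_triangle_ineq] add_mono norm_le_SUP)
  next
    case (11 x y)
    then show ?case
      by (auto intro!: cSUP_least mult_mono norm_le_SUP nonneg simp: norm_mult)
  next
    case (12 s)
    then have s: "bounded (range (s n))" for n by simp
    have "\<exists>l. bounded (range l) \<and> (\<lambda>n. SUP j. norm (s n j - l j)) \<longlonglongrightarrow> 0"
      using 12(2) by (intro ell_infinity_complete) (simp_all add: s minus_ell_infinity)
    then show ?case
      by (auto simp: s minus_ell_infinity cong: conj_cong)
  qed (auto simp: bounded_range_mult algebra_simps)
  show "cstar_algebra_axioms ?A"
  proof (rule cstar_algebra_axioms.intro, goal_cases)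
    case (6 x)
    then have "bdd_above (range (\<lambda>j. norm (x j)))"
      by (auto simp: bounded_iff bdd_above_def)
    then show ?case
      using SUP_power2[of "\<lambda>j. norm (x j)"] by (simp add: norm_mult power2_eq_square)
  qed (auto simp: bounded_range_cconj cconj_add cconj_mult power2_eq_square)
qed

section \<open>Transport along isometric *-isomorphisms\<close>

text \<open>Every operation on images is the image of an operation in \<open>A\<close>, where the
  inverse cancels \<open>f\<close> because \<open>A\<close> is closed. It turns the map from
  sequences to operators into one from operators to sequences.\<close>

lemma isometric_star_isomorphism_inv_into:
  assumes A: "cstar_algebra A" "ring A" and f: "isometric_star_isomorphism A B f"
  shows "isometric_star_isomorphism B A (inv_into (carrier A) f)"
proof -
  interpret cstar_algebra A by fact
  interpret ring A by fact
  let ?g = "inv_into (carrier A) f"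
  from f have bij: "bij_betw f (carrier A) (carrier B)" and hom: "f \<in> ring_hom A B"
    and rest: "\<And>c x. x \<in> carrier A \<Longrightarrow> f (c \<odot>\<^bsub>A\<^esub> x) = c \<odot>\<^bsub>B\<^esub> f x"
      "\<And>x. x \<in> carrier A \<Longrightarrow> f (involution A x) = involution B (f x)"
      "\<And>x. x \<in> carrier A \<Longrightarrow> anorm B (f x) = anorm A x"
    by (auto simp: isometric_star_isomorphism_def)
  have g [simp]: "?g (f x) = x" if "x \<in> carrier A" for x
    using bij that by (simp add: bij_betw_inv_into_left)
  have im: "carrier B = f ` carrier A"
    using bij by (simp add: bij_betw_def)
  have "?g (c \<odot>\<^bsub>B\<^esub> f x) = c \<odot>\<^bsub>A\<^esub> x" if "x \<in> carrier A" for c x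
    using that smult_closed[of c x] by (simp flip: rest)
  moreover have "?g (involution B (f x)) = involution A x" if "x \<in> carrier A" for x
    using that involution_closed[of x] by (simp flip: rest)
  moreover have "?g (f x \<otimes>\<^bsub>B\<^esub> f y) = x \<otimes>\<^bsub>A\<^esub> y" "?g (f x \<oplus>\<^bsub>B\<^esub> f y) = x \<oplus>\<^bsub>A\<^esub> y"
    if "x \<in> carrier A" "y \<in> carrier A" for x y
    using that by (simp_all flip: ring_hom_mult[OF hom] ring_hom_add[OF hom])
  moreover have "?g \<one>\<^bsub>B\<^esub> = \<one>\<^bsub>A\<^esub>"
    by (simp flip: ring_hom_one[OF hom])
  ultimately show ?thesis
    using bij_betw_inv_into[OF bij]
    by (auto simp: isometric_star_isomorphism_def im rest intro!: ring_hom_memI)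
qed

text \<open>
  The condition on \<open>\<zero>\<close> is not implied by \<open>isometric_star_isomorphism\<close>
  as long as nothing is known about \<open>B\<close>.
\<close>

lemma commutative_unital_cstar_algebra_transfer:
  assumes A: "commutative_unital_cstar_algebra A" and f: "isometric_star_isomorphism A B f"
    and f0: "f \<zero>\<^bsub>A\<^esub> = \<zero>\<^bsub>B\<^esub>"
  shows "commutative_unital_cstar_algebra B"
proof (intro commutative_unital_cstar_algebra.intro cstar_algebra.intro banach_algebra.intro)
  interpret A: commutative_unital_cstar_algebra A by fact
  from f have bij: "bij_betw f (carrier A) (carrier B)" and hom: "f \<in> ring_hom A B"
    and rest: "\<And>c x. x \<in> carrier A \<Longrightarrow> c \<odot>\<^bsub>B\<^esub> f x = f (c \<odot>\<^bsub>A\<^esub> x)"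
      "\<And>x. x \<in> carrier A \<Longrightarrow> involution B (f x) = f (involution A x)"
      "\<And>x. x \<in> carrier A \<Longrightarrow> anorm B (f x) = anorm A x"
    by (auto simp: isometric_star_isomorphism_def)
  \<comment> \<open>The equations are oriented to pull every operation of \<open>B\<close> inside
    \<open>f\<close>; with \<open>im\<close>, each axiom of \<open>B\<close> becomes the image of an
    axiom of \<open>A\<close>.\<close>
  note f_simps = rest ring_hom_mult[OF hom, symmetric] ring_hom_add[OF hom, symmetric]
    ring_hom_one[OF hom, symmetric] f0[symmetric]
  have im: "carrier B = f ` carrier A"
    using bij by (simp add: bij_betw_def)
  have inj: "f x = f y \<longleftrightarrow> x = y" if "x \<in> carrier A" "y \<in> carrier A" for x y
    using bij that by (auto simp: bij_betw_def inj_on_def)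
  have minv: "\<exists>y\<in>carrier A. y \<oplus>\<^bsub>A\<^esub> x = \<zero>\<^bsub>A\<^esub>" if "x \<in> carrier A" for x
    using that A.l_neg by blast
  have grp: "abelian_group B"
  proof (rule abelian_groupI, goal_cases)
    case (6 x)
    then obtain y where y: "y \<in> carrier A" "x = f y" by (auto simp: im)
    with minv obtain z where "z \<in> carrier A" "z \<oplus>\<^bsub>A\<^esub> y = \<zero>\<^bsub>A\<^esub>" by blast
    with y show ?case by (intro bexI[of _ "f z"]) (auto simp: im f_simps)
  qed (auto simp: im f_simps A.a_ac)
  then interpret B: abelian_group B .
  \<comment> \<open>Subtraction rests on uniqueness of inverses in \<open>B\<close>, so the group
    structure had to come first; the completeness axiom uses it.\<close>
  have minus: "f x \<ominus>\<^bsub>B\<^esub> f y = f (x \<ominus>\<^bsub>A\<^esub> y)" if "x \<in> carrier A" "y \<in> carrier A" for x y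
  proof -
    have "\<ominus>\<^bsub>B\<^esub> f y = f (\<ominus>\<^bsub>A\<^esub> y)"
      using that by (intro B.minus_equality) (auto simp: im f_simps A.l_neg)
    then show ?thesis using that by (simp add: a_minus_def f_simps)
  qed
  show "cring B"
  proof (rule cringI[OF grp])
    show "comm_monoid B"
      by (rule comm_monoidI) (auto simp: im f_simps A.m_ac)
  qed (auto simp: im f_simps A.l_distr)
  have smult: "c \<odot>\<^bsub>A\<^esub> x \<in> carrier A" if "x \<in> carrier A" for c x
    using that A.smult_closed[of c x] by simp
  have smult_simps: "(c + d) \<odot>\<^bsub>A\<^esub> x = c \<odot>\<^bsub>A\<^esub> x \<oplus>\<^bsub>A\<^esub> d \<odot>\<^bsub>A\<^esub> x"
    "c \<odot>\<^bsub>A\<^esub> (x \<oplus>\<^bsub>A\<^esub> y) = c \<odot>\<^bsub>A\<^esub> x \<oplus>\<^bsub>A\<^esub> c \<odot>\<^bsub>A\<^esub> y"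
    "(c * d) \<odot>\<^bsub>A\<^esub> x = c \<odot>\<^bsub>A\<^esub> (d \<odot>\<^bsub>A\<^esub> x)" "1 \<odot>\<^bsub>A\<^esub> x = x"
    if "x \<in> carrier A" "y \<in> carrier A" for c d x y
    using that A.smult_l_distr[of c d x] A.smult_r_distr[of c x y] A.smult_assoc1[of c d x]
      A.smult_one[of x]
    by simp_all
  show "Module.module ring_of_type_algebra B"
    by (rule moduleI) (auto simp: im f_simps smult smult_simps cring_ring_of_type_algebra grp)
  show "banach_algebra_axioms B"
  proof (rule banach_algebra_axioms.intro, goal_cases)
    case (12 s)
    then have "\<forall>n. \<exists>t. t \<in> carrier A \<and> s n = f t"
      unfolding im by blast
    then obtain t where t: "\<And>n. t n \<in> carrier A" and s: "\<And>n. s n = f (t n)" by metis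
    have "\<exists>l\<in>carrier A. (\<lambda>n. anorm A (t n \<ominus>\<^bsub>A\<^esub> l)) \<longlonglongrightarrow> 0"
      using 12(2) by (intro A.complete) (simp_all add: t s minus f_simps)
    then show ?case
      by (auto simp: im s t minus f_simps)
  qed (auto simp: im f_simps smult inj A.l_distr A.r_distr A.smult_mult_left A.smult_mult_right
      A.anorm_nonneg A.anorm_eq_0_iff A.anorm_smult A.anorm_triangle A.anorm_mult A.m_assoc)
  show "cstar_algebra_axioms B"
    by (rule cstar_algebra_axioms.intro)
      (auto simp: im f_simps smult A.involution_closed A.involution_involution A.involution_add
        A.involution_smult A.involution_mult A.cstar_identity)
qed

section \<open>Inner product and norm\<close>

context hilbert_space
begin

lemma ip_add_right: "ip x (y + z) = ip x y + ip x z"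
  by (metis ip_add_left ip_commute cconj_add)

lemma ip_scale_right: "ip x (scale c y) = cconj c * ip x y"
  by (metis ip_scale_left ip_commute cconj_mult)

lemma ip_minus_left: "ip (- x) y = - ip x y"
  using ip_scale_left[of "-1" x y] by simp

lemma ip_diff_left: "ip (x - y) z = ip x z - ip y z"
  using ip_add_left[of x "- y" z] by (simp add: ip_minus_left)

lemma ip_diff_right: "ip x (y - z) = ip x y - ip x z"
  using ip_add_right[of x "y - z" z] by (simp add: algebra_simps)

lemma ip_zero_left [simp]: "ip 0 y = 0"
  using ip_scale_left[of 0 0 y] by simp

lemma ip_zero_right [simp]: "ip x 0 = 0"
  using ip_scale_right[of x 0 0] by simp

lemma ip_sum_left: "ip (sum f F) y = (\<Sum>j\<in>F. ip (f j) y)"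
  by (induction F rule: infinite_finite_induct) (simp_all add: ip_add_left)

lemma ip_sum_right: "ip x (sum f F) = (\<Sum>j\<in>F. ip x (f j))"
  by (induction F rule: infinite_finite_induct) (simp_all add: ip_add_right)

text \<open>\<open>of_real\<close> is injective, so identities between squared norms can be computed
  in the scalar field.\<close>

lemma norm_power2_eqI: "ip x x = of_real r \<Longrightarrow> (norm x)\<^sup>2 = r"
  using ip_self[of x] by (metis of_real_eq_iff)

lemma norm_scale: "norm (scale c x) = norm c * norm x"
proof -
  have "(norm (scale c x))\<^sup>2 = (norm c * norm x)\<^sup>2"
  proof (rule norm_power2_eqI)
    have "ip (scale c x) (scale c x) = (c * cconj c) * ip x x"
      by (simp add: ip_scale_left ip_scale_right)
    then show "ip (scale c x) (scale c x) = of_real ((norm c * norm x)\<^sup>2)"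
      by (simp add: mult_cconj ip_self power_mult_distrib)
  qed
  then show ?thesis by simp
qed

text \<open>Cauchy-Schwarz: the part of \<open>x\<close> left after projecting onto the line of
  \<open>y\<close> has nonnegative squared norm.\<close>

lemma norm_ip_le: "norm (ip x y) \<le> norm x * norm y"
proof (cases "y = 0")
  case False
  \<comment> \<open>The coefficient of the orthogonal projection of \<open>x\<close> onto the line
    of \<open>y\<close>.\<close>
  define c where "c = of_real (inverse ((norm y)\<^sup>2)) * ip x y"
  have "(norm (x - scale c y))\<^sup>2 = (norm x)\<^sup>2 - (norm (ip x y))\<^sup>2 / (norm y)\<^sup>2"
  proof (rule norm_power2_eqI)
    have c: "c * of_real ((norm y)\<^sup>2) = ip x y"
      using False by (simp add: c_def)
    have "ip (x - scale c y) (x - scale c y) =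
        ip x x - c * cconj (ip x y) - (ip x y - c * of_real ((norm y)\<^sup>2)) * cconj c"
      unfolding ip_diff_left ip_diff_right ip_scale_left ip_scale_right ip_commute[of y x]
      by (simp add: ip_self[of y] algebra_simps)
    also have "\<dots> = ip x x - of_real (inverse ((norm y)\<^sup>2)) * (ip x y * cconj (ip x y))"
      unfolding c by (simp add: c_def)
    also have "\<dots> = of_real ((norm x)\<^sup>2 - (norm (ip x y))\<^sup>2 / (norm y)\<^sup>2)"
      by (simp add: mult_cconj ip_self field_simps)
    finally show "ip (x - scale c y) (x - scale c y) =
      of_real ((norm x)\<^sup>2 - (norm (ip x y))\<^sup>2 / (norm y)\<^sup>2)" .
  qed
  then have "0 \<le> (norm x)\<^sup>2 - (norm (ip x y))\<^sup>2 / (norm y)\<^sup>2"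
    by (metis zero_le_power2)
  then have "(norm (ip x y))\<^sup>2 \<le> (norm x * norm y)\<^sup>2"
    using False by (simp add: field_simps power_mult_distrib)
  then show ?thesis
    by (rule power2_le_imp_le) simp
qed simp

text \<open>Cauchy-Schwarz supplies the bound. Continuity in this form lets the inner product be
  taken term by term in infinite sums.\<close>

lemma bounded_linear_ip_left: "bounded_linear (\<lambda>x. ip x y)"
proof (rule bounded_linear_intro[where K = "norm y"])
  fix x r
  show "ip (r *\<^sub>R x) y = r *\<^sub>R ip x y"
    unfolding scale_of_real[symmetric] by (simp add: ip_scale_left scaleR_conv_of_real)
qed (auto simp: ip_add_left norm_ip_le)

end

section \<open>Expansion in the orthonormal basis\<close>

context hilbert_space_with_basis
begin

lemma norm_basis [simp]: "norm (\<phi> j) = 1"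
proof -
  have "(norm (\<phi> j))\<^sup>2 = 1"
    by (rule norm_power2_eqI) (simp add: orthonormal)
  then show ?thesis
    using norm_ge_zero[of "\<phi> j"] unfolding power2_eq_1_iff by linarith
qed

lemma coefficient_add: "coefficient (x + y) j = coefficient x j + coefficient y j"
  by (simp add: coefficient_def ip_add_left)

lemma coefficient_diff: "coefficient (x - y) j = coefficient x j - coefficient y j"
  by (simp add: coefficient_def ip_diff_left)

lemma coefficient_scale: "coefficient (scale c x) j = c * coefficient x j"
  by (simp add: coefficient_def ip_scale_left)

lemma coefficient_zero [simp]: "coefficient 0 j = 0"
  by (simp add: coefficient_def)

lemma coefficient_basis: "coefficient (\<phi> i) j = (if i = j then 1 else 0)"
  by (simp add: coefficient_def orthonormal)

lemma norm_coefficient_le: "norm (coefficient x j) \<le> norm x"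
  using norm_ip_le[of x "\<phi> j"] by (simp add: coefficient_def)

text \<open>The coefficients are arbitrary, so that the same sums also approximate the series of
  diagonal operators.\<close>

definition partial_sum :: "(int \<Rightarrow> 'f) \<Rightarrow> int set \<Rightarrow> 'h" where
  "partial_sum c F = (\<Sum>j\<in>F. scale (c j) (\<phi> j))"

lemma coefficient_partial_sum:
  "finite F \<Longrightarrow> coefficient (partial_sum c F) i = (if i \<in> F then c i else 0)"
  by (simp add: partial_sum_def coefficient_def ip_sum_left ip_scale_left orthonormal if_distrib
      cong: if_cong)

lemma ip_partial_sum_right:
  "ip x (partial_sum c F) = (\<Sum>j\<in>F. cconj (c j) * coefficient x j)"
  by (simp add: partial_sum_def coefficient_def ip_sum_right ip_scale_right)

text \<open>Pythagoras for finitely many orthogonal vectors.\<close>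

lemma norm_partial_sum:
  assumes "finite F"
  shows "(norm (partial_sum c F))\<^sup>2 = (\<Sum>j\<in>F. (norm (c j))\<^sup>2)"
proof (rule norm_power2_eqI)
  have "cconj (c j) * c j = of_real ((norm (c j))\<^sup>2)" for j
    using mult_cconj[of "c j"] by (simp add: mult.commute)
  then show "ip (partial_sum c F) (partial_sum c F) = of_real (\<Sum>j\<in>F. (norm (c j))\<^sup>2)"
    by (simp add: ip_partial_sum_right coefficient_partial_sum[OF assms])
qed

text \<open>The partial sum is the orthogonal projection of \<open>x\<close>, so the remainder is
  orthogonal to it and Pythagoras applies.\<close>

lemma norm_diff_partial_sum_coefficient_le:
  assumes "finite F"
  shows "norm (x - partial_sum (coefficient x) F) \<le> norm x"
proof -
  define p where "p = partial_sum (coefficient x) F"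
  have 0: "ip (x - p) p = 0"
    unfolding p_def ip_partial_sum_right
    by (rule sum.neutral) (simp add: coefficient_diff coefficient_partial_sum[OF assms])
  have "ip x x = ip ((x - p) + p) ((x - p) + p)" by simp
  also have "\<dots> = ip (x - p) (x - p) + ip p p"
    unfolding ip_add_left ip_add_right using 0 ip_commute[of p "x - p"] by simp
  finally have "(norm x)\<^sup>2 = (norm (x - p))\<^sup>2 + (norm p)\<^sup>2"
    by (intro norm_power2_eqI) (simp add: ip_self)
  then have "(norm (x - p))\<^sup>2 \<le> (norm x)\<^sup>2" by simp
  then show ?thesis
    unfolding p_def by (rule power2_le_imp_le) simp
qed

lemma partial_sum_coefficient_add:
  "partial_sum (coefficient (x + y)) F = partial_sum (coefficient x) F + partial_sum (coefficient y) F"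
  by (simp add: partial_sum_def coefficient_add scale_left_distrib sum.distrib)

lemma partial_sum_coefficient_diff:
  "partial_sum (coefficient (x - y)) F = partial_sum (coefficient x) F - partial_sum (coefficient y) F"
  by (simp add: partial_sum_def coefficient_diff scale_left_diff_distrib sum_subtractf)

lemma partial_sum_coefficient_scale:
  "partial_sum (coefficient (scale c x)) F = scale c (partial_sum (coefficient x) F)"
  by (simp add: partial_sum_def coefficient_scale scale_sum_right)

text \<open>A finite linear combination involves finitely many basis vectors, so its expansion is
  exact from some finite index set on.\<close>

lemma partial_sum_coefficient_of_span:
  assumes "y \<in> span (range \<phi>)"
  shows "\<exists>F. finite F \<and> (\<forall>G. finite G \<and> F \<subseteq> G \<longrightarrow> partial_sum (coefficient y) G = y)"
  using assms
proof (induction rule: span_induct_alt)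
  case base
  show ?case by (intro exI[of _ "{}"]) (simp add: partial_sum_def)
next
  case (step c x y)
  then obtain i F where i: "x = \<phi> i" and F: "finite F"
    "\<And>G. finite G \<Longrightarrow> F \<subseteq> G \<Longrightarrow> partial_sum (coefficient y) G = y" by blast
  have "partial_sum (coefficient x) G = x" if "finite G" "i \<in> G" for G
    using that by (simp add: i partial_sum_def coefficient_basis if_distrib if_distribR cong: if_cong)
  then show ?case
    using F by (intro exI[of _ "insert i F"])
      (simp add: partial_sum_coefficient_add partial_sum_coefficient_scale)
qed

text \<open>Approximate \<open>x\<close> by some \<open>y\<close> in the span. Once the partial sums
  reproduce \<open>y\<close>, the error for \<open>x\<close> is the remainder of
  \<open>x - y\<close>, whose norm is at most that of \<open>x - y\<close>.\<close>

lemma has_sum_coefficient: "((\<lambda>j. scale (coefficient x j) (\<phi> j)) has_sum x) UNIV"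
  unfolding has_sum_def tendsto_iff eventually_finite_subsets_at_top
proof (intro allI impI)
  fix e :: real assume "0 < e"
  obtain y where y: "y \<in> span (range \<phi>)" "dist y x < e"
    using total \<open>0 < e\<close> by (metis UNIV_I closure_approachable)
  obtain F where F: "finite F"
    "\<And>G. finite G \<Longrightarrow> F \<subseteq> G \<Longrightarrow> partial_sum (coefficient y) G = y"
    using partial_sum_coefficient_of_span[OF y(1)] by blast
  have "dist (partial_sum (coefficient x) G) x < e" if G: "finite G" "F \<subseteq> G" for G
  proof -
    have "x - partial_sum (coefficient x) G = (x - y) - partial_sum (coefficient (x - y)) G"
      by (simp add: partial_sum_coefficient_diff F(2)[OF G])
    then have "norm (x - partial_sum (coefficient x) G) \<le> norm (x - y)"
      by (simp only: norm_diff_partial_sum_coefficient_le[OF G(1)])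
    then show ?thesis using y(2) by (simp add: dist_norm norm_minus_commute)
  qed
  then show "\<exists>F. finite F \<and> F \<subseteq> UNIV \<and> (\<forall>G. finite G \<and> F \<subseteq> G \<and> G \<subseteq> UNIV \<longrightarrow>
      dist (\<Sum>j\<in>G. scale (coefficient x j) (\<phi> j)) x < e)"
    using F(1) unfolding partial_sum_def by blast
qed

text \<open>The expansion determines the vector; this reduces identities between operators to
  identities between scalars.\<close>

lemma eqI_coefficient:
  assumes "\<And>j. coefficient x j = coefficient y j"
  shows "x = y"
  by (rule has_sum_unique[OF has_sum_coefficient]) (simp only: assms has_sum_coefficient)

text \<open>Parseval's identity for inner products, from continuity in the first argument.\<close>

lemma has_sum_ip: "((\<lambda>j. coefficient x j * cconj (coefficient y j)) has_sum ip x y) UNIV"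
proof -
  have "((\<lambda>j. ip (scale (coefficient x j) (\<phi> j)) y) has_sum ip x y) UNIV"
    by (rule has_sum_bounded_linear[OF bounded_linear_ip_left has_sum_coefficient])
  then show ?thesis
    unfolding ip_scale_left coefficient_def by (simp add: ip_commute[symmetric])
qed

text \<open>Parseval's identity for norms: the squared norms of the partial sums converge by
  continuity of the norm.\<close>

lemma has_sum_norm: "((\<lambda>j. (norm (coefficient x j))\<^sup>2) has_sum (norm x)\<^sup>2) UNIV"
proof -
  have "((\<lambda>F. partial_sum (coefficient x) F) \<longlongrightarrow> x) (finite_subsets_at_top UNIV)"
    using has_sum_coefficient[of x] unfolding has_sum_def partial_sum_def .
  then have "((\<lambda>F. (norm (partial_sum (coefficient x) F))\<^sup>2) \<longlongrightarrow> (norm x)\<^sup>2) (finite_subsets_at_top UNIV)"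
    by (intro tendsto_intros)
  then show ?thesis
    unfolding has_sum_def
    by (rule Lim_transform_eventually)
      (auto intro!: eventually_finite_subsets_at_top_weakI norm_partial_sum)
qed

section \<open>Diagonal operators\<close>

text \<open>\<open>infsum\<close> returns \<open>0\<close> when the sum does not exist; convergence
  for bounded \<open>m\<close> is shown in \<open>has_sum_diagonal\<close>.\<close>

definition diagonal :: "(int \<Rightarrow> 'f) \<Rightarrow> 'h \<Rightarrow> 'h" where
  "diagonal m x = (\<Sum>\<^sub>\<infinity>j. scale (m j * coefficient x j) (\<phi> j))"

lemma star_product_eq_diagonal: "x \<star> y = diagonal (coefficient x) y"
  by (simp add: star_product_def diagonal_def)

lemma bounded_coefficient: "bounded (range (coefficient x))"
  using norm_coefficient_le by (auto simp: bounded_iff)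

text \<open>The difference is written as a single partial sum with signs recording membership, so
  that the Pythagorean formula applies to it.\<close>

lemma partial_sum_diff:
  assumes "finite F" "finite G"
  shows "partial_sum c F - partial_sum c G =
    partial_sum (\<lambda>j. (of_bool (j \<in> F) - of_bool (j \<in> G)) * c j) (F \<union> G)"
proof -
  have "coefficient (partial_sum c F - partial_sum c G) i =
    coefficient (partial_sum (\<lambda>j. (of_bool (j \<in> F) - of_bool (j \<in> G)) * c j) (F \<union> G)) i" for i
    using assms by (simp add: coefficient_diff coefficient_partial_sum)
  then show ?thesis by (rule eqI_coefficient)
qed

text \<open>The factor \<open>m j\<close> enlarges each squared coefficient of the difference by at
  most \<open>M\<^sup>2\<close>.\<close>

lemma dist_partial_sum_mult_le:
  assumes "finite F" "finite G" and M: "\<And>j. norm (m j) \<le> M"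
  shows "dist (partial_sum (\<lambda>j. m j * c j) F) (partial_sum (\<lambda>j. m j * c j) G)
    \<le> M * dist (partial_sum c F) (partial_sum c G)"
proof -
  let ?d = "\<lambda>j. of_bool (j \<in> F) - of_bool (j \<in> G) :: 'f"
  have M0: "0 \<le> M" using M[of 0] norm_ge_zero order_trans by blast
  have "(norm (?d j * (m j * c j)))\<^sup>2 \<le> M\<^sup>2 * (norm (?d j * c j))\<^sup>2" for j
    using M[of j] M0 unfolding power_mult_distrib[symmetric] norm_mult
    by (intro power_mono) (auto simp: mult.commute[of M] mult.commute[of "norm (m j)"] intro!: mult_left_mono)
  then have "(norm (partial_sum (\<lambda>j. m j * c j) F - partial_sum (\<lambda>j. m j * c j) G))\<^sup>2
      \<le> (M * norm (partial_sum c F - partial_sum c G))\<^sup>2"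
    using assms(1,2)
    by (simp add: partial_sum_diff norm_partial_sum power_mult_distrib sum_distrib_left sum_mono)
  then show ?thesis
    unfolding dist_norm by (rule power2_le_imp_le) (simp add: M0)
qed

text \<open>The partial sums of \<open>x\<close> converge and hence are Cauchy; the preceding
  estimate passes this on to the multiplied sums, and completeness of the space gives a
  limit.\<close>

lemma has_sum_diagonal:
  assumes "bounded (range m)"
  shows "((\<lambda>j. scale (m j * coefficient x j) (\<phi> j)) has_sum diagonal m x) UNIV"
proof -
  let ?c = "coefficient x" and ?F = "finite_subsets_at_top (UNIV :: int set)"
  let ?p = "\<lambda>F. partial_sum ?c F" and ?q = "\<lambda>F. partial_sum (\<lambda>j. m j * ?c j) F"
  obtain M where M0: "0 < M" and M: "\<And>j. norm (m j) \<le> M"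
    using assms unfolding bounded_pos by auto
  have "(?p \<longlongrightarrow> x) ?F"
    using has_sum_coefficient[of x] unfolding has_sum_def partial_sum_def .
  then have Cp: "cauchy_filter (filtermap ?p ?F)"
    by (auto intro!: nhds_imp_cauchy_filter simp: filterlim_def)
  have "cauchy_filter (filtermap ?q ?F)"
    unfolding cauchy_filter_metric_filtermap
  proof (intro allI impI)
    fix e :: real assume "0 < e"
    then have "0 < e / M" using M0 by simp
    then obtain P where "eventually P ?F \<and> (\<forall>F G. P F \<and> P G \<longrightarrow> dist (?p F) (?p G) < e / M)"
      using Cp[unfolded cauchy_filter_metric_filtermap] by meson
    then have P: "eventually P ?F" "\<And>F G. P F \<Longrightarrow> P G \<Longrightarrow> dist (?p F) (?p G) < e / M"
      by auto
    \<comment> \<open>Finiteness is added to \<open>P\<close> because the distance estimate holds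
      for finite index sets.\<close>
    have "dist (?q F) (?q G) < e" if "finite F \<and> P F" "finite G \<and> P G" for F G
    proof -
      have "dist (?q F) (?q G) \<le> M * dist (?p F) (?p G)"
        using that M by (intro dist_partial_sum_mult_le) auto
      also have "\<dots> < e"
        using P(2)[of F G] that M0 by (simp add: field_simps)
      finally show ?thesis .
    qed
    moreover have "eventually (\<lambda>F. finite F \<and> P F) ?F"
      using P(1) by (intro eventually_conj) (auto intro: eventually_finite_subsets_at_top_weakI)
    ultimately show "\<exists>P. eventually P ?F \<and> (\<forall>F G. P F \<and> P G \<longrightarrow> dist (?q F) (?q G) < e)"
      by blast
  qed
  moreover have "complete (UNIV :: 'h set)"
    by (meson Cauchy_convergent UNIV_I complete_def convergent_def)
  ultimately obtain l where "(?q \<longlongrightarrow> l) ?F"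
    using complete_uniform[where S = "UNIV :: 'h set"] by (force simp add: filterlim_def)
  then have "(\<lambda>j. scale (m j * ?c j) (\<phi> j)) summable_on UNIV"
    unfolding summable_on_def has_sum_def partial_sum_def by blast
  then show ?thesis
    unfolding diagonal_def by (rule has_sum_infsum)
qed

text \<open>Coefficients are continuous, so they may be taken term by term, and orthonormality
  leaves only the term at \<open>i\<close>.\<close>

lemma coefficient_diagonal:
  assumes "bounded (range m)"
  shows "coefficient (diagonal m x) i = m i * coefficient x i"
proof -
  have "((\<lambda>j. coefficient (scale (m j * coefficient x j) (\<phi> j)) i) has_sum coefficient (diagonal m x) i) UNIV"
    unfolding coefficient_def
    by (rule has_sum_bounded_linear[OF bounded_linear_ip_left has_sum_diagonal[OF assms, unfolded coefficient_def]])
  moreover have "((\<lambda>j. coefficient (scale (m j * coefficient x j) (\<phi> j)) i) has_sum m i * coefficient x i) UNIV"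
    by (rule has_sum_finite_neutralI[of "{i}"])
      (auto simp: coefficient_scale coefficient_basis)
  ultimately show ?thesis by (rule has_sum_unique)
qed

lemma coefficient_star_product: "coefficient (x \<star> y) j = coefficient x j * coefficient y j"
  by (simp add: star_product_eq_diagonal coefficient_diagonal bounded_coefficient)

text \<open>Parseval's identity on both sides reduces the bound to a comparison of terms.\<close>

lemma norm_diagonal_le:
  assumes "\<And>j. norm (m j) \<le> M"
  shows "norm (diagonal m x) \<le> M * norm x"
proof -
  have bd: "bounded (range m)" using assms by (auto simp: bounded_iff)
  have M0: "0 \<le> M" using assms[of 0] norm_ge_zero order_trans by blast
  have "(norm (diagonal m x))\<^sup>2 \<le> M\<^sup>2 * (norm x)\<^sup>2"
  proof (rule has_sum_mono)
    show "((\<lambda>j. M\<^sup>2 * (norm (coefficient x j))\<^sup>2) has_sum M\<^sup>2 * (norm x)\<^sup>2) UNIV"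
      by (rule has_sum_cmult_right[OF has_sum_norm])
    fix j
    show "(norm (coefficient (diagonal m x) j))\<^sup>2 \<le> M\<^sup>2 * (norm (coefficient x j))\<^sup>2"
      using assms[of j]
      by (simp add: coefficient_diagonal[OF bd] norm_mult power_mult_distrib mult_right_mono power_mono)
  qed (rule has_sum_norm)
  then have "(norm (diagonal m x))\<^sup>2 \<le> (M * norm x)\<^sup>2"
    by (simp add: power_mult_distrib)
  then show ?thesis
    by (rule power2_le_imp_le) (simp add: M0)
qed

lemma diagonal_basis: "bounded (range m) \<Longrightarrow> diagonal m (\<phi> j) = scale (m j) (\<phi> j)"
  by (rule eqI_coefficient) (simp add: coefficient_diagonal coefficient_scale coefficient_basis)

section \<open>Quasitubes are the diagonal operators\<close>

text \<open>In coefficients the star product is entrywise multiplication, so \<open>H_linear\<close>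
  becomes distributivity and commutativity in the scalar field.\<close>

lemma diagonal_in_quasitubes:
  assumes "bounded (range m)"
  shows "diagonal m \<in> quasitubes"
proof -
  have "H_linear (diagonal m)"
    unfolding H_linear_def
    by (intro allI eqI_coefficient)
      (simp add: coefficient_diagonal[OF assms] coefficient_add coefficient_star_product algebra_simps)
  moreover have "\<exists>K. \<forall>x. norm (diagonal m x) \<le> K * norm x"
    using norm_diagonal_le[of m, OF norm_le_SUP[OF assms]] by blast
  ultimately show ?thesis by (simp add: quasitubes_def)
qed

text \<open>The idea is that \<open>\<phi> j \<star> x\<close> is the projection of \<open>x\<close> to the line of \<open>\<phi> j\<close>.\<close>

lemma coefficient_quasitube:
  assumes "H_linear q"
  shows "coefficient (q x) j = coefficient (q (\<phi> j)) j * coefficient x j"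
proof -
  have zero: "a \<star> 0 = 0" for a
    by (rule eqI_coefficient) (simp add: coefficient_star_product)
  \<comment> \<open>The second factor pair in \<open>H_linear\<close> is set to \<open>0\<close>;
    its contribution \<open>0 \<star> q 0\<close> vanishes whatever \<open>q 0\<close> is.\<close>
  have star: "q (a \<star> y) = a \<star> q y" for a y
  proof -
    have "0 \<star> y = 0" for y
      by (rule eqI_coefficient) (simp add: coefficient_star_product)
    then show ?thesis
      using assms[unfolded H_linear_def, rule_format, of a y 0 0] by simp
  qed
  \<comment> \<open>Applying \<open>q\<close> to the two orders of this product moves it onto
    \<open>x\<close> on one side and onto \<open>\<phi> j\<close> on the other.\<close>
  have "\<phi> j \<star> x = x \<star> \<phi> j"
    by (rule eqI_coefficient) (simp add: coefficient_star_product mult.commute)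
  then have "\<phi> j \<star> q x = x \<star> q (\<phi> j)"
    by (simp flip: star)
  then have "coefficient (\<phi> j \<star> q x) j = coefficient (x \<star> q (\<phi> j)) j"
    by simp
  then show ?thesis
    by (simp add: coefficient_star_product coefficient_basis)
qed

text \<open>The symbol of \<open>q\<close> consists of its diagonal entries on the basis; they are
  bounded by \<open>K\<close> because the basis vectors are unit vectors.\<close>

lemma quasitubes_eq: "quasitubes = diagonal ` {m. bounded (range m)}"
proof (intro antisym subsetI)
  fix q assume "q \<in> quasitubes"
  then obtain K where q: "H_linear q" and K: "\<And>x. norm (q x) \<le> K * norm x"
    by (auto simp: quasitubes_def)
  define m where "m j = coefficient (q (\<phi> j)) j" for j
  have "norm (m j) \<le> K" for j
    unfolding m_def using norm_coefficient_le[of "q (\<phi> j)" j] K[of "\<phi> j"] by simp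
  then have bd: "bounded (range m)" by (auto simp: bounded_iff)
  moreover have "q x = diagonal m x" for x
    by (rule eqI_coefficient) (simp add: coefficient_diagonal[OF bd] coefficient_quasitube[OF q, of x] m_def)
  ultimately show "q \<in> diagonal ` {m. bounded (range m)}" by auto
qed (auto intro: diagonal_in_quasitubes)

lemma inj_on_diagonal: "inj_on diagonal {m. bounded (range m)}"
proof (rule inj_onI)
  fix m n :: "int \<Rightarrow> 'f"
  assume m: "m \<in> {m. bounded (range m)}" and n: "n \<in> {m. bounded (range m)}"
    and eq: "diagonal m = diagonal n"
  show "m = n"
  proof
    fix j
    show "m j = n j"
      using coefficient_diagonal[of m "\<phi> j" j] coefficient_diagonal[of n "\<phi> j" j] m n eq
      by (simp add: coefficient_basis)
  qed
qed

section \<open>Norm, adjoint and algebra operations of diagonal operators\<close>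

text \<open>The upper bound is \<open>norm_diagonal_le\<close>; the unit vectors
  \<open>\<phi> j\<close> are eigenvectors with eigenvalues \<open>m j\<close> and give the lower
  bound.\<close>

lemma quasitube_norm_diagonal:
  assumes "bounded (range m)"
  shows "quasitube_norm (diagonal m) = (SUP j. norm (m j))"
proof (rule antisym)
  have le: "norm (diagonal m x) \<le> (SUP j. norm (m j))" if "norm x = 1" for x
    using norm_diagonal_le[of m _ x, OF norm_le_SUP[OF assms]] that by simp
  have "{x :: 'h. norm x = 1} \<noteq> {}" using norm_basis by blast
  then show "quasitube_norm (diagonal m) \<le> (SUP j. norm (m j))"
    unfolding quasitube_norm_def by (rule cSUP_least) (use le in auto)
  show "(SUP j. norm (m j)) \<le> quasitube_norm (diagonal m)"
  proof (rule cSUP_least)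
    fix j
    have "norm (m j) = norm (diagonal m (\<phi> j))"
      by (simp add: diagonal_basis[OF assms] norm_scale)
    also have "\<dots> \<le> quasitube_norm (diagonal m)"
      unfolding quasitube_norm_def using le by (intro cSUP_upper) (auto simp: bdd_above_def)
    finally show "norm (m j) \<le> quasitube_norm (diagonal m)" .
  qed simp
qed

text \<open>The adjoint is a definite description, so existence and uniqueness are both due.
  Existence compares the two Parseval sums term by term.\<close>

lemma hilbert_adjoint_diagonal:
  assumes m: "bounded (range m)"
  shows "hilbert_adjoint (diagonal m) = diagonal (\<lambda>j. cconj (m j))"
  unfolding hilbert_adjoint_def
proof (rule the_equality)
  note m' = bounded_range_cconj[OF m]
  have adj: "ip (diagonal m x) y = ip x (diagonal (\<lambda>j. cconj (m j)) y)" for x y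
    using has_sum_ip[of "diagonal m x" y] has_sum_ip[of x "diagonal (\<lambda>j. cconj (m j)) y"]
    by (simp add: coefficient_diagonal[OF m] coefficient_diagonal[OF m'] cconj_mult mult_ac has_sum_unique)
  then show "\<forall>x y. ip (diagonal m x) y = ip x (diagonal (\<lambda>j. cconj (m j)) y)" by blast
  fix r assume r: "\<forall>x y. ip (diagonal m x) y = ip x (r y)"
  \<comment> \<open>Uniqueness: testing the adjoint relation at \<open>x = \<phi> j\<close>
    determines every coefficient of \<open>r y\<close>.\<close>
  have "r y = diagonal (\<lambda>j. cconj (m j)) y" for y
  proof (rule eqI_coefficient)
    fix j
    show "coefficient (r y) j = coefficient (diagonal (\<lambda>j. cconj (m j)) y) j"
      unfolding coefficient_def using r adj by (metis ip_commute)
  qed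
  then show "r = diagonal (\<lambda>j. cconj (m j))" ..
qed

lemma quasitube_algebra_simps [simp]:
  "carrier quasitube_algebra = quasitubes"
  "p \<otimes>\<^bsub>quasitube_algebra\<^esub> q = p \<circ> q"
  "\<one>\<^bsub>quasitube_algebra\<^esub> = id"
  "\<zero>\<^bsub>quasitube_algebra\<^esub> = (\<lambda>x. 0)"
  "p \<oplus>\<^bsub>quasitube_algebra\<^esub> q = (\<lambda>x. p x + q x)"
  "c \<odot>\<^bsub>quasitube_algebra\<^esub> q = (\<lambda>x. scale c (q x))"
  "involution quasitube_algebra = hilbert_adjoint"
  "anorm quasitube_algebra = quasitube_norm"
  by (simp_all add: quasitube_algebra_def)

lemma diagonal_mult:
  assumes "bounded (range m)" "bounded (range n)"
  shows "diagonal (\<lambda>j. m j * n j) = diagonal m \<circ> diagonal n"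
  using assms
  by (intro ext eqI_coefficient) (simp add: coefficient_diagonal bounded_range_mult)

lemma diagonal_add:
  assumes "bounded (range m)" "bounded (range n)"
  shows "diagonal (\<lambda>j. m j + n j) = (\<lambda>x. diagonal m x + diagonal n x)"
  using assms
  by (intro ext eqI_coefficient)
    (simp add: coefficient_diagonal bounded_range_add coefficient_add algebra_simps)

lemma diagonal_smult:
  assumes "bounded (range m)"
  shows "diagonal (\<lambda>j. c * m j) = (\<lambda>x. scale c (diagonal m x))"
  using assms bounded_range_mult[OF bounded_range_const assms]
  by (intro ext eqI_coefficient) (simp add: coefficient_diagonal coefficient_scale)

lemma diagonal_one: "diagonal (\<lambda>j. 1) = id"
  by (intro ext eqI_coefficient) (simp add: coefficient_diagonal)

lemma diagonal_zero: "diagonal (\<lambda>j. 0) = (\<lambda>x. 0)"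
  by (intro ext eqI_coefficient) (simp add: coefficient_diagonal)

lemma isometric_star_isomorphism_diagonal:
  "isometric_star_isomorphism ell_infinity quasitube_algebra diagonal"
proof -
  have "carrier ell_infinity = {m :: int \<Rightarrow> 'f. bounded (range m)}" by auto
  then have "bij_betw diagonal (carrier ell_infinity) (carrier quasitube_algebra)"
    by (simp add: bij_betw_def inj_on_diagonal quasitubes_eq)
  then show ?thesis
    by (auto simp: isometric_star_isomorphism_def quasitube_norm_diagonal hilbert_adjoint_diagonal
        diagonal_in_quasitubes diagonal_smult diagonal_mult[symmetric] diagonal_add diagonal_one
        intro!: ring_hom_memI)
qed

end

theorem theorem4p4:
  fixes scale :: "'f::real_or_complex \<Rightarrow> 'h::banach \<Rightarrow> 'h"
    and ip :: "'h \<Rightarrow> 'h \<Rightarrow> 'f"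
    and \<phi> :: "int \<Rightarrow> 'h"
  assumes "hilbert_space_with_basis scale ip \<phi>"
  shows "commutative_unital_cstar_algebra (hilbert_space_with_basis.quasitube_algebra scale ip \<phi>) \<and>
    (\<exists>f. isometric_star_isomorphism
      (hilbert_space_with_basis.quasitube_algebra scale ip \<phi>)
      (ell_infinity :: ('f, int \<Rightarrow> 'f) normed_star_algebra) f)"
proof -
  interpret hilbert_space_with_basis scale ip \<phi> by fact
  interpret ell: commutative_unital_cstar_algebra "ell_infinity :: ('f, int \<Rightarrow> 'f) normed_star_algebra"
    by (rule commutative_unital_cstar_algebra_ell_infinity)
  \<comment> \<open>The axioms travel from sequences to operators along \<open>diagonal\<close>; the
    isomorphism asked for is its inverse.\<close>
  have "commutative_unital_cstar_algebra quasitube_algebra"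
    by (rule commutative_unital_cstar_algebra_transfer[OF
        commutative_unital_cstar_algebra_ell_infinity isometric_star_isomorphism_diagonal])
      (simp add: diagonal_zero)
  moreover have "isometric_star_isomorphism quasitube_algebra ell_infinity
      (inv_into (carrier ell_infinity) diagonal)"
    by (rule isometric_star_isomorphism_inv_into[OF ell.cstar_algebra_axioms ell.ring_axioms
        isometric_star_isomorphism_diagonal])
  ultimately show ?thesis by blast
qed

end
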